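(* Let $H$ be a graph that is not isomorphic to $K_{1,3}$. The class of $H$-free near-bipartite graphs is ifvs-identical if and only if $H$ is (isomorphic to) a (not necessarily induced) subgraph of $P_3$.
   Context: Graphs are finite, simple and undirected. A graph is $H$-free if it has no induced subgraph isomorphic to $H$. $P_n$ is the path on $n$ vertices; $K_{1,3}$ is the star with three leaves. A subgraph of a graph is obtained by deleting vertices and/or edges. A feedback vertex set of $G$ is a set $S\subseteq V(G)$ such that $G-S$ is a forest; it is independent if $S$ is an independent set. A graph is near-bipartite if it has an independent feedback vertex set. For a near-bipartite graph $G$, $\mathrm{fvs}(G)$ is the minimum size of a feedback vertex set and $\mathrm{ifvs}(G)$ is the minimum size of an independent feedback vertex set. A class $\mathcal X$ of near-bipartite graphs is ifvs-identical if $\mathrm{ifvs}(G)=\mathrm{fvs}(G)$ for every $G\in\mathcal X$. *)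

theory Defs
  imports Main "HOL-Library.Infinite_Typeclass"
begin

record 'v graph =
  verts :: "'v set"
  edges :: "'v set set"

definition simple_graph :: "'v graph \<Rightarrow> bool" where
  "simple_graph G \<longleftrightarrow>
     finite (verts G) \<and> (\<forall>e\<in>edges G. e \<subseteq> verts G \<and> card e = 2)"

definition graph_iso :: "'a graph \<Rightarrow> 'b graph \<Rightarrow> bool" where
  "graph_iso G H \<longleftrightarrow>
     (\<exists>f. bij_betw f (verts G) (verts H) \<and>
          (\<forall>u\<in>verts G. \<forall>v\<in>verts G. {u, v} \<in> edges G \<longleftrightarrow> {f u, f v} \<in> edges H))"

definition subgraph :: "'v graph \<Rightarrow> 'v graph \<Rightarrow> bool" where
  "subgraph K G \<longleftrightarrow> simple_graph K \<and> verts K \<subseteq> verts G \<and> edges K \<subseteq> edges G"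

definition induced_subgraph :: "'v graph \<Rightarrow> 'v set \<Rightarrow> 'v graph" where
  "induced_subgraph G W = \<lparr>verts = verts G \<inter> W, edges = {e \<in> edges G. e \<subseteq> W}\<rparr>"

definition delete_verts :: "'v graph \<Rightarrow> 'v set \<Rightarrow> 'v graph" where
  "delete_verts G S = induced_subgraph G (verts G - S)"

definition graph_free :: "'a graph \<Rightarrow> 'v graph \<Rightarrow> bool" where
  "graph_free H G \<longleftrightarrow> \<not> (\<exists>W\<subseteq>verts G. graph_iso (induced_subgraph G W) H)"

definition path_graph :: "nat \<Rightarrow> nat graph" where
  "path_graph n = \<lparr>verts = {..<n}, edges = {{i, Suc i} | i. Suc i < n}\<rparr>"

text \<open>\<open>star_graph s\<close> is $K_{1,s}$, with centre \<open>0\<close>.\<close>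

definition star_graph :: "nat \<Rightarrow> nat graph" where
  "star_graph s = \<lparr>verts = {..s}, edges = {{0, i} | i. i \<in> {1..s}}\<rparr>"

text \<open>A cycle is the list of its vertices; the closing edge is the case
  \<open>i = length vs - 1\<close>.\<close>

definition is_cycle :: "'v graph \<Rightarrow> 'v list \<Rightarrow> bool" where
  "is_cycle G vs \<longleftrightarrow>
     3 \<le> length vs \<and> distinct vs \<and> set vs \<subseteq> verts G \<and>
     (\<forall>i<length vs. {vs ! i, vs ! (Suc i mod length vs)} \<in> edges G)"

definition is_forest :: "'v graph \<Rightarrow> bool" where
  "is_forest G \<longleftrightarrow> \<not> (\<exists>vs. is_cycle G vs)"

definition independent_set :: "'v graph \<Rightarrow> 'v set \<Rightarrow> bool" where
  "independent_set G S \<longleftrightarrow> S \<subseteq> verts G \<and> (\<forall>u\<in>S. \<forall>v\<in>S. {u, v} \<notin> edges G)"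

definition feedback_vertex_set :: "'v graph \<Rightarrow> 'v set \<Rightarrow> bool" where
  "feedback_vertex_set G S \<longleftrightarrow> S \<subseteq> verts G \<and> is_forest (delete_verts G S)"

definition indep_feedback_vertex_set :: "'v graph \<Rightarrow> 'v set \<Rightarrow> bool" where
  "indep_feedback_vertex_set G S \<longleftrightarrow> feedback_vertex_set G S \<and> independent_set G S"

definition near_bipartite :: "'v graph \<Rightarrow> bool" where
  "near_bipartite G \<longleftrightarrow> (\<exists>S. indep_feedback_vertex_set G S)"

definition fvs :: "'v graph \<Rightarrow> nat" where
  "fvs G = (LEAST k. \<exists>S. feedback_vertex_set G S \<and> card S = k)"

text \<open>Meaningful only for near-bipartite graphs: otherwise \<open>LEAST\<close> ranges over an
  empty set of sizes. The same restriction applies to \<open>ifvs_identical\<close>.\<close>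

definition ifvs :: "'v graph \<Rightarrow> nat" where
  "ifvs G = (LEAST k. \<exists>S. indep_feedback_vertex_set G S \<and> card S = k)"

definition ifvs_identical :: "'v graph set \<Rightarrow> bool" where
  "ifvs_identical X \<longleftrightarrow> (\<forall>G\<in>X. ifvs G = fvs G)"

text \<open>Over an infinite vertex type every finite graph has an isomorphic copy, so this is
  the class of all \<open>H\<close>-free near-bipartite graphs up to isomorphism.\<close>

definition free_near_bipartite_class :: "'a graph \<Rightarrow> 'v::infinite graph set" where
  "free_near_bipartite_class H = {G. simple_graph G \<and> near_bipartite G \<and> graph_free H G}"

end

theory Submission
  imports Defs
begin

text \<open>
  If \<open>H\<close> lies in \<open>P\<^sub>3\<close>, then an \<open>H\<close>-free graph has no induced \<open>3P\<^sub>1\<close>, no induced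
  \<open>P\<^sub>3\<close> or no induced \<open>P\<^sub>1 + P\<^sub>2\<close>. In the first case independent sets have at most two
  vertices, in the second a minimum feedback vertex set is independent because \<open>K\<^sub>4\<close> is not
  near-bipartite, and in the third the graph is complete multipartite.

  Conversely, if \<open>H\<close> has a cycle, it is missing from a graph of large girth whose only
  feedback vertex set of size two is a pair of adjacent hubs. A forest on at least four vertices
  other than \<open>K\<^bsub>1,3\<^esub>\<close> has four vertices that induce a linear forest, since any four
  vertices would otherwise form a star, which is impossible on five vertices. Of the five linear
  forests on four vertices, \<open>4P\<^sub>1\<close> and \<open>2P\<^sub>2\<close> are missing from a graph on seven vertices with
  \<open>fvs = 2\<close> and \<open>ifvs = 3\<close>, the other three from the join of \<open>2P\<^sub>2\<close> and \<open>4P\<^sub>1\<close>, with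
  \<open>fvs = 3\<close> and \<open>ifvs = 4\<close>.
\<close>

section \<open>Cycles and forests\<close>

lemma delete_verts_simps [simp]:
  "verts (delete_verts G S) = verts G - S"
  "e \<in> edges (delete_verts G S) \<longleftrightarrow> e \<in> edges G \<and> e \<subseteq> verts G - S"
  by (auto simp: delete_verts_def induced_subgraph_def)

lemma simple_graph_edgeD:
  assumes "simple_graph G" "{x, y} \<in> edges G"
  shows "x \<in> verts G" "y \<in> verts G" "x \<noteq> y"
  using assms by (fastforce simp: simple_graph_def)+

lemma is_cycle_map:
  assumes "is_cycle G vs" "inj_on f (verts G)" "f ` verts G \<subseteq> verts G'"
    and "\<And>x y. x \<in> verts G \<Longrightarrow> y \<in> verts G \<Longrightarrow> {x, y} \<in> edges G \<Longrightarrow> {f x, f y} \<in> edges G'"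
  shows "is_cycle G' (map f vs)"
  unfolding is_cycle_def
proof (intro conjI allI impI)
  show "distinct (map f vs)"
    using assms(1,2) by (auto simp: is_cycle_def distinct_map inj_on_subset)
next
  fix i assume i: "i < length (map f vs)"
  then have j: "Suc i mod length vs < length vs" by (auto intro: mod_less_divisor)
  have "vs ! i \<in> verts G" "vs ! (Suc i mod length vs) \<in> verts G"
    using assms(1) i j by (auto simp: is_cycle_def subset_iff)
  then show "{map f vs ! i, map f vs ! (Suc i mod length (map f vs))} \<in> edges G'"
    using assms(1,4) i j by (auto simp: is_cycle_def)
next
  show "set (map f vs) \<subseteq> verts G'" using assms(1,3) unfolding is_cycle_def by force
qed (use assms(1) in \<open>auto simp: is_cycle_def\<close>)

lemma is_cycle_delete_verts:
  assumes "is_cycle G vs" "set vs \<inter> S = {}"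
  shows "is_cycle (delete_verts G S) vs"
proof -
  have "Suc i mod length vs < length vs" if "i < length vs" for i
    using that by (auto intro: mod_less_divisor)
  then have "{vs ! i, vs ! (Suc i mod length vs)} \<subseteq> set vs" if "i < length vs" for i
    using that by auto
  moreover have "set vs \<subseteq> verts G - S" using assms by (auto simp: is_cycle_def)
  ultimately have "{vs ! i, vs ! (Suc i mod length vs)} \<subseteq> verts G - S" if "i < length vs" for i
    using that by (metis subset_trans)
  with \<open>set vs \<subseteq> verts G - S\<close> assms(1) show ?thesis by (simp add: is_cycle_def)
qed

lemma is_cycle_mono_delete:
  assumes "is_cycle (delete_verts G S) vs"
  shows "is_cycle G vs" "set vs \<inter> S = {}"
  using assms by (auto simp: is_cycle_def)

lemma feedback_vertex_setD:
  assumes "feedback_vertex_set G S" "is_cycle G vs"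
  shows "set vs \<inter> S \<noteq> {}"
  using assms is_cycle_delete_verts unfolding feedback_vertex_set_def is_forest_def by blast

text \<open>These are the successor and the predecessor on the cycle; they differ because a cycle
  has at least three vertices.\<close>

lemma cycle_two_neighbours:
  assumes "is_cycle G vs" "x \<in> set vs"
  shows "\<exists>y\<in>set vs. \<exists>z\<in>set vs. y \<noteq> z \<and> y \<noteq> x \<and> z \<noteq> x \<and> {x, y} \<in> edges G \<and> {x, z} \<in> edges G"
proof -
  let ?n = "length vs"
  have n: "3 \<le> ?n" and d: "distinct vs"
    and e: "\<And>i. i < ?n \<Longrightarrow> {vs ! i, vs ! (Suc i mod ?n)} \<in> edges G"
    using assms(1) by (auto simp: is_cycle_def)
  obtain i where i: "i < ?n" "x = vs ! i" using assms(2) by (auto simp: in_set_conv_nth)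
  define j where "j = (if Suc i = ?n then 0 else Suc i)"
  define k where "k = (if i = 0 then ?n - 1 else i - 1)"
  have jk: "j < ?n" "k < ?n" "j \<noteq> k" "j \<noteq> i" "k \<noteq> i"
    using n i by (auto simp: j_def k_def)
  have "Suc i mod ?n = j" "Suc k mod ?n = i" using i n by (auto simp: j_def k_def)
  then have "{x, vs ! j} \<in> edges G" "{x, vs ! k} \<in> edges G"
    using e[OF i(1)] e[OF jk(2)] i by (auto simp: insert_commute)
  then show ?thesis using jk i d
    by (intro bexI[of _ "vs ! j"] bexI[of _ "vs ! k"]) (auto simp: nth_eq_iff_index_eq)
qed

text \<open>On a cycle, a vertex of maximal rank has two neighbours of no larger rank.\<close>

lemma is_forest_rank:
  fixes r :: "'v \<Rightarrow> nat"
  assumes "\<And>x y z. \<lbrakk>{x, y} \<subseteq> verts G; z \<in> verts G; {x, y} \<in> edges G; {x, z} \<in> edges G;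
      r y \<le> r x; r z \<le> r x\<rbrakk> \<Longrightarrow> y = z"
  shows "is_forest G"
  unfolding is_forest_def
proof
  assume "\<exists>vs. is_cycle G vs"
  then obtain vs where c: "is_cycle G vs" by blast
  then have ne: "set vs \<noteq> {}" and sub: "set vs \<subseteq> verts G" by (auto simp: is_cycle_def)
  have "Max (r ` set vs) \<in> r ` set vs" using ne by (intro Max_in) auto
  then obtain x where x: "x \<in> set vs" "r x = Max (r ` set vs)" by auto
  have max: "r y \<le> r x" if "y \<in> set vs" for y using that by (simp add: x(2))
  obtain y z where yz: "y \<in> set vs" "z \<in> set vs" "y \<noteq> z" "{x, y} \<in> edges G" "{x, z} \<in> edges G"
    using cycle_two_neighbours[OF c x(1)] by blast
  then have "y = z" using assms[of x y z] max sub x(1) by blast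
  with yz show False by blast
qed

text \<open>For a rooted forest: \<open>p\<close> sends a vertex to its parent and \<open>r\<close>
  grows away from the roots, so two neighbours of no larger rank would both be
  \<open>p x\<close>.\<close>

lemma is_forest_parent:
  fixes r :: "'v \<Rightarrow> nat"
  assumes "\<And>x y. \<lbrakk>x \<in> verts G; y \<in> verts G; {x, y} \<in> edges G; r y \<le> r x\<rbrakk> \<Longrightarrow> y = p x"
  shows "is_forest G"
proof (rule is_forest_rank[where r = r])
  fix x y z
  assume "{x, y} \<subseteq> verts G" "z \<in> verts G" "{x, y} \<in> edges G" "{x, z} \<in> edges G"
    "r y \<le> r x" "r z \<le> r x"
  then have "y = p x" "z = p x" using assms[of x y] assms[of x z] by blast+
  then show "y = z" by simp
qed

lemma is_cycle_3I:
  assumes "distinct [a, b, c]" "{a, b, c} \<subseteq> verts G"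
    "{a, b} \<in> edges G" "{b, c} \<in> edges G" "{c, a} \<in> edges G"
  shows "is_cycle G [a, b, c]"
  unfolding is_cycle_def
proof (intro conjI allI impI)
  fix i assume "i < length [a, b, c]"
  then consider "i = 0" | "i = 1" | "i = 2" by force
  then show "{[a, b, c] ! i, [a, b, c] ! (Suc i mod length [a, b, c])} \<in> edges G"
    using assms by cases simp_all
qed (use assms in auto)

lemma is_cycle_4I:
  assumes "distinct [a, b, c, d]" "{a, b, c, d} \<subseteq> verts G"
    "{a, b} \<in> edges G" "{b, c} \<in> edges G" "{c, d} \<in> edges G" "{d, a} \<in> edges G"
  shows "is_cycle G [a, b, c, d]"
  unfolding is_cycle_def
proof (intro conjI allI impI)
  fix i assume "i < length [a, b, c, d]"
  then consider "i = 0" | "i = 1" | "i = 2" | "i = 3" by force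
  then show "{[a, b, c, d] ! i, [a, b, c, d] ! (Suc i mod length [a, b, c, d])} \<in> edges G"
    using assms by cases simp_all
qed (use assms in auto)

section \<open>Feedback vertex numbers\<close>

lemma fvs_le: "feedback_vertex_set G S \<Longrightarrow> fvs G \<le> card S"
  unfolding fvs_def by (rule Least_le) blast

lemma fvs_attained: "\<exists>S. feedback_vertex_set G S \<and> card S = fvs G"
proof -
  \<comment> \<open>Deleting every vertex leaves no cycle, so \<open>LEAST\<close> ranges over a
    nonempty set.\<close>
  have "feedback_vertex_set G (verts G)"
    by (auto simp: feedback_vertex_set_def intro: is_forest_rank)
  then have "\<exists>k S. feedback_vertex_set G S \<and> card S = k" by blast
  then show ?thesis unfolding fvs_def by (rule LeastI_ex)
qed

lemma ifvs_le: "indep_feedback_vertex_set G S \<Longrightarrow> ifvs G \<le> card S"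
  unfolding ifvs_def by (rule Least_le) blast

lemma ifvs_attained:
  assumes "near_bipartite G"
  shows "\<exists>S. indep_feedback_vertex_set G S \<and> card S = ifvs G"
proof -
  have "\<exists>k S. indep_feedback_vertex_set G S \<and> card S = k"
    using assms by (auto simp: near_bipartite_def)
  then show ?thesis unfolding ifvs_def by (rule LeastI_ex)
qed

lemma near_bipartiteI:
  assumes "is_forest (delete_verts G S)" "independent_set G S"
  shows "near_bipartite G"
  using assms unfolding near_bipartite_def indep_feedback_vertex_set_def feedback_vertex_set_def
    independent_set_def by blast

lemma fvs_le_ifvs: "near_bipartite G \<Longrightarrow> fvs G \<le> ifvs G"
  by (metis ifvs_attained fvs_le indep_feedback_vertex_set_def)

text \<open>Closes the chain \<open>ifvs G \<le> card S \<le> fvs G \<le> ifvs G\<close>; every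
  positive case ends with it.\<close>

lemma ifvs_eq_fvsI:
  assumes "indep_feedback_vertex_set G S" "card S \<le> fvs G"
  shows "ifvs G = fvs G"
  using assms ifvs_le[OF assms(1)] fvs_le_ifvs[of G] unfolding near_bipartite_def by fastforce

section \<open>Invariance of the feedback vertex numbers under isomorphism\<close>

text \<open>A cycle that avoids the image of \<open>S\<close> is pulled back along the inverse of
  \<open>f\<close> to a cycle that avoids \<open>S\<close>.\<close>

lemma feedback_vertex_set_image:
  assumes f: "bij_betw f (verts G) (verts G')"
    and e: "\<And>x y. x \<in> verts G \<Longrightarrow> y \<in> verts G \<Longrightarrow> {x, y} \<in> edges G \<longleftrightarrow> {f x, f y} \<in> edges G'"
    and S: "feedback_vertex_set G S"
  shows "feedback_vertex_set G' (f ` S)"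
proof -
  let ?g = "inv_into (verts G) f"
  have g: "bij_betw ?g (verts G') (verts G)" by (rule bij_betw_inv_into[OF f])
  have fg: "f (?g x) = x" "?g x \<in> verts G" if "x \<in> verts G'" for x
    using f g that by (auto simp: bij_betw_inv_into_right bij_betwE)
  then have gS: "?g x \<in> verts G \<and> ?g x \<notin> S" if "x \<in> verts G'" "x \<notin> f ` S" for x
    using that by (metis image_eqI)
  have "\<not> is_cycle (delete_verts G' (f ` S)) vs" for vs
  proof
    assume "is_cycle (delete_verts G' (f ` S)) vs"
    then have "is_cycle (delete_verts G S) (map ?g vs)"
    proof (rule is_cycle_map)
      show "inj_on ?g (verts (delete_verts G' (f ` S)))"
        using g by (auto simp: bij_betw_def intro: inj_on_subset)
      show "?g ` verts (delete_verts G' (f ` S)) \<subseteq> verts (delete_verts G S)"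
        by (auto simp: gS)
    next
      fix x y
      assume "x \<in> verts (delete_verts G' (f ` S))" "y \<in> verts (delete_verts G' (f ` S))"
        "{x, y} \<in> edges (delete_verts G' (f ` S))"
      then show "{?g x, ?g y} \<in> edges (delete_verts G S)"
        using fg e[of "?g x" "?g y"] gS by simp
    qed
    then show False using S by (auto simp: feedback_vertex_set_def is_forest_def)
  qed
  moreover have "f ` S \<subseteq> verts G'"
    using S f by (auto simp: feedback_vertex_set_def bij_betw_def)
  ultimately show ?thesis by (simp add: feedback_vertex_set_def is_forest_def)
qed

lemma indep_feedback_vertex_set_image:
  assumes f: "bij_betw f (verts G) (verts G')"
    and e: "\<And>x y. x \<in> verts G \<Longrightarrow> y \<in> verts G \<Longrightarrow> {x, y} \<in> edges G \<longleftrightarrow> {f x, f y} \<in> edges G'"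
    and S: "indep_feedback_vertex_set G S"
  shows "indep_feedback_vertex_set G' (f ` S)"
proof -
  have "independent_set G' (f ` S)"
    unfolding independent_set_def
  proof (intro conjI ballI)
    have sub: "S \<subseteq> verts G" and ind: "\<And>u v. u \<in> S \<Longrightarrow> v \<in> S \<Longrightarrow> {u, v} \<notin> edges G"
      using S by (auto simp: indep_feedback_vertex_set_def independent_set_def)
    show "f ` S \<subseteq> verts G'" using sub f by (auto simp: bij_betw_def)
    fix u v assume "u \<in> f ` S" "v \<in> f ` S"
    then obtain x y where "x \<in> S" "y \<in> S" "u = f x" "v = f y" by blast
    then show "{u, v} \<notin> edges G'" using sub ind[of x y] e[of x y] by auto
  qed
  then show ?thesis
    using S feedback_vertex_set_image[OF f e] by (auto simp: indep_feedback_vertex_set_def)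
qed

lemma card_image_iso:
  "bij_betw f V V' \<Longrightarrow> S \<subseteq> V \<Longrightarrow> card (f ` S) = card S"
  by (meson bij_betw_def card_image inj_on_subset)

lemma graph_iso_sym:
  assumes "graph_iso G H"
  shows "graph_iso H G"
proof -
  obtain f where f: "bij_betw f (verts G) (verts H)"
    and e: "\<And>u v. u \<in> verts G \<Longrightarrow> v \<in> verts G \<Longrightarrow> {u, v} \<in> edges G \<longleftrightarrow> {f u, f v} \<in> edges H"
    using assms by (auto simp: graph_iso_def)
  let ?g = "inv_into (verts G) f"
  have g: "bij_betw ?g (verts H) (verts G)" by (rule bij_betw_inv_into[OF f])
  have "{u, v} \<in> edges H \<longleftrightarrow> {?g u, ?g v} \<in> edges G" if "u \<in> verts H" "v \<in> verts H" for u v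
    using e[of "?g u" "?g v"] that f g by (auto simp: bij_betw_inv_into_right bij_betwE)
  with g show ?thesis by (auto simp: graph_iso_def)
qed

lemma near_bipartite_iso: "graph_iso G G' \<Longrightarrow> near_bipartite G \<Longrightarrow> near_bipartite G'"
  unfolding graph_iso_def near_bipartite_def by (meson indep_feedback_vertex_set_image)

lemma fvs_iso_le:
  assumes "graph_iso G G'"
  shows "fvs G' \<le> fvs G"
proof -
  obtain f where f: "bij_betw f (verts G) (verts G')"
    and e: "\<And>u v. u \<in> verts G \<Longrightarrow> v \<in> verts G \<Longrightarrow> {u, v} \<in> edges G \<longleftrightarrow> {f u, f v} \<in> edges G'"
    using assms by (auto simp: graph_iso_def)
  obtain S where S: "feedback_vertex_set G S" "card S = fvs G" using fvs_attained by blast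
  then show ?thesis using feedback_vertex_set_image[OF f e] fvs_le card_image_iso[OF f]
    by (metis feedback_vertex_set_def)
qed

lemma ifvs_iso_le:
  assumes "graph_iso G G'" "near_bipartite G"
  shows "ifvs G' \<le> ifvs G"
proof -
  obtain f where f: "bij_betw f (verts G) (verts G')"
    and e: "\<And>u v. u \<in> verts G \<Longrightarrow> v \<in> verts G \<Longrightarrow> {u, v} \<in> edges G \<longleftrightarrow> {f u, f v} \<in> edges G'"
    using assms by (auto simp: graph_iso_def)
  obtain S where S: "indep_feedback_vertex_set G S" "card S = ifvs G"
    using ifvs_attained assms by blast
  then show ?thesis using indep_feedback_vertex_set_image[OF f e] ifvs_le card_image_iso[OF f]
    by (metis feedback_vertex_set_def indep_feedback_vertex_set_def)
qed

section \<open>Induced embeddings\<close>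

text \<open>Induced copies are handled as maps rather than as vertex subsets, because maps
  compose.\<close>

definition embeds :: "'a graph \<Rightarrow> 'b graph \<Rightarrow> ('a \<Rightarrow> 'b) \<Rightarrow> bool" where
  "embeds H G h \<longleftrightarrow> inj_on h (verts H) \<and> h ` verts H \<subseteq> verts G \<and>
     (\<forall>u\<in>verts H. \<forall>v\<in>verts H. {u, v} \<in> edges H \<longleftrightarrow> {h u, h v} \<in> edges G)"

lemma graph_free_iff: "graph_free H G \<longleftrightarrow> \<not> (\<exists>h. embeds H G h)"
proof -
  have "(\<exists>W\<subseteq>verts G. graph_iso (induced_subgraph G W) H) \<longleftrightarrow> (\<exists>h. embeds H G h)"
  proof
    assume "\<exists>W\<subseteq>verts G. graph_iso (induced_subgraph G W) H"
    then obtain W where W: "W \<subseteq> verts G" "graph_iso H (induced_subgraph G W)"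
      using graph_iso_sym by blast
    then obtain h where h: "bij_betw h (verts H) W"
      "\<forall>u\<in>verts H. \<forall>v\<in>verts H. {u, v} \<in> edges H \<longleftrightarrow> {h u, h v} \<in> edges G \<and> {h u, h v} \<subseteq> W"
      by (auto simp: graph_iso_def induced_subgraph_def Int_absorb1)
    then have "embeds H G h" using W(1) by (fastforce simp: embeds_def bij_betw_def)
    then show "\<exists>h. embeds H G h" by blast
  next
    assume "\<exists>h. embeds H G h"
    then obtain h where h: "embeds H G h" ..
    then have "graph_iso H (induced_subgraph G (h ` verts H))"
      unfolding graph_iso_def
      by (intro exI[of _ h]) (auto simp: embeds_def induced_subgraph_def bij_betw_def)
    then show "\<exists>W\<subseteq>verts G. graph_iso (induced_subgraph G W) H"
      using h graph_iso_sym unfolding embeds_def by blast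
  qed
  then show ?thesis by (simp add: graph_free_def)
qed

lemma embeds_comp:
  assumes "embeds H G h" "embeds G G' f"
  shows "embeds H G' (f \<circ> h)"
  using assms unfolding embeds_def
  by (auto simp: image_subset_iff intro: comp_inj_on inj_on_subset)

lemma graph_iso_embeds: "graph_iso G G' \<Longrightarrow> \<exists>f. embeds G G' f"
  by (auto simp: graph_iso_def embeds_def bij_betw_def)

lemma graph_free_iso:
  assumes "graph_iso G G'" "graph_free H G"
  shows "graph_free H G'"
  using assms embeds_comp graph_iso_embeds[OF graph_iso_sym[OF assms(1)]]
  unfolding graph_free_iff by blast

section \<open>Counterexamples on an arbitrary infinite vertex type\<close>

definition image_graph :: "('a \<Rightarrow> 'b) \<Rightarrow> 'a graph \<Rightarrow> 'b graph" where
  "image_graph f G = \<lparr>verts = f ` verts G, edges = image f ` edges G\<rparr>"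

lemma
  assumes sg: "simple_graph G" and inj: "inj_on f (verts G)"
  shows simple_image_graph: "simple_graph (image_graph f G)"
    and graph_iso_image_graph: "graph_iso G (image_graph f G)"
proof -
  have sub: "e \<subseteq> verts G" "card e = 2" if "e \<in> edges G" for e
    using sg that by (auto simp: simple_graph_def)
  then show "simple_graph (image_graph f G)"
    using sg inj by (auto simp: simple_graph_def image_graph_def card_image inj_on_subset)
  have "{f u, f v} \<in> edges (image_graph f G) \<longleftrightarrow> {u, v} \<in> edges G"
    if "u \<in> verts G" "v \<in> verts G" for u v
  proof -
    have "f ` {u, v} = f ` e \<longleftrightarrow> {u, v} = e" if "e \<in> edges G" for e
      using inj_on_image_eq_iff[OF inj, of "{u, v}" e] sub(1)[OF that]
        \<open>u \<in> verts G\<close> \<open>v \<in> verts G\<close> by simp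
    then show ?thesis unfolding image_graph_def by (auto simp: image_iff)
  qed
  then show "graph_iso G (image_graph f G)" unfolding graph_iso_def
    using inj by (intro exI[of _ f]) (auto simp: image_graph_def bij_betw_def)
qed

lemma simple_graph_copy:
  assumes "simple_graph (G :: 'b graph)"
  shows "\<exists>G' :: 'v::infinite graph. simple_graph G' \<and> graph_iso G G'"
proof -
  have fin: "finite (verts G)" using assms by (simp add: simple_graph_def)
  obtain B :: "'v set" where "finite B" "card B = card (verts G)"
    using infinite_arbitrarily_large[OF infinite_UNIV] by blast
  then obtain f where "bij_betw f (verts G) B" using fin finite_same_card_bij by metis
  then have "inj_on f (verts G)" by (simp add: bij_betw_def)
  then show ?thesis using simple_image_graph graph_iso_image_graph assms by blast
qed

text \<open>Lets each counterexample live on a convenient vertex type: its copy over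
  \<open>'v\<close> keeps \<open>H\<close>-freeness and the gap between the two numbers.\<close>

lemma not_ifvs_identicalI:
  assumes "simple_graph (G :: 'b graph)" "near_bipartite G" "graph_free H G" "fvs G < ifvs G"
  shows "\<not> ifvs_identical (free_near_bipartite_class H :: 'v::infinite graph set)"
proof -
  obtain G' :: "'v graph" where G': "simple_graph G'" "graph_iso G G'"
    using simple_graph_copy[OF assms(1)] by blast
  have "fvs G' \<le> fvs G" by (rule fvs_iso_le[OF G'(2)])
  moreover have nb: "near_bipartite G'" using near_bipartite_iso G' assms by blast
  moreover have "ifvs G \<le> ifvs G'" by (rule ifvs_iso_le[OF graph_iso_sym[OF G'(2)] nb])
  ultimately have "ifvs G' \<noteq> fvs G'" using assms(4) by simp
  then show ?thesis using G' nb graph_free_iso[OF G'(2) assms(3)]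
    by (auto simp: ifvs_identical_def free_near_bipartite_class_def)
qed

definition rel_graph :: "'v set \<Rightarrow> ('v \<Rightarrow> 'v \<Rightarrow> bool) \<Rightarrow> 'v graph" where
  "rel_graph V R = \<lparr>verts = V, edges = {{x, y} | x y. x \<in> V \<and> y \<in> V \<and> x \<noteq> y \<and> (R x y \<or> R y x)}\<rparr>"

lemma rel_graph_simps [simp]:
  "verts (rel_graph V R) = V"
  "{x, y} \<in> edges (rel_graph V R) \<longleftrightarrow> x \<in> V \<and> y \<in> V \<and> x \<noteq> y \<and> (R x y \<or> R y x)"
  by (auto simp: rel_graph_def doubleton_eq_iff)

lemma simple_rel_graph: "finite V \<Longrightarrow> simple_graph (rel_graph V R)"
  by (auto simp: simple_graph_def rel_graph_def)

section \<open>Forbidding an induced subgraph on three vertices\<close>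

text \<open>Independent sets have at most two vertices, hence \<open>ifvs G \<le> 2\<close>; and a
  feedback vertex set with at most one vertex is already independent.\<close>

lemma ifvs_eq_fvs_3P1_free:
  assumes sg: "simple_graph G" and nb: "near_bipartite G"
    and free: "\<And>x y z. \<lbrakk>{x, y, z} \<subseteq> verts G; distinct [x, y, z]\<rbrakk> \<Longrightarrow>
      {x, y} \<in> edges G \<or> {x, z} \<in> edges G \<or> {y, z} \<in> edges G"
  shows "ifvs G = fvs G"
proof -
  obtain I where I: "indep_feedback_vertex_set G I" "card I = ifvs G"
    using ifvs_attained nb by blast
  have "card I \<le> 2"
  proof (rule ccontr)
    assume "\<not> card I \<le> 2"
    then obtain J where "J \<subseteq> I" "card J = 3" by (metis obtain_subset_with_card_n not_less_eq_eq numeral_2_eq_2 numeral_3_eq_3)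
    then obtain x y z where "{x, y, z} \<subseteq> I" "distinct [x, y, z]" by (auto simp: card_3_iff)
    then show False using free[of x y z] I(1)
      by (auto simp: indep_feedback_vertex_set_def independent_set_def)
  qed
  obtain S where S: "feedback_vertex_set G S" "card S = fvs G" using fvs_attained by blast
  show ?thesis
  proof (cases "card S \<le> 1")
    case True
    have "finite S" using S(1) sg by (auto simp: feedback_vertex_set_def simple_graph_def intro: finite_subset)
    then have "x = y" if "x \<in> S" "y \<in> S" for x y using True that card_le_Suc0_iff_eq by auto
    then have "indep_feedback_vertex_set G S" using S(1) simple_graph_edgeD(3)[OF sg]
      unfolding indep_feedback_vertex_set_def independent_set_def feedback_vertex_set_def by blast
    then show ?thesis using S(2) ifvs_eq_fvsI by fastforce
  next
    case False
    then show ?thesis using I \<open>card I \<le> 2\<close> S(2) ifvs_eq_fvsI by fastforce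
  qed
qed

text \<open>By minimality, adjacent vertices \<open>u, v\<close> of a minimum feedback vertex set \<open>S\<close> would yield
  a cycle meeting \<open>S\<close> only in \<open>u\<close>; together with \<open>v\<close> the neighbours of \<open>u\<close> on it form a \<open>K\<^sub>4\<close>.\<close>

lemma ifvs_eq_fvs_P3_free:
  assumes sg: "simple_graph G" and nb: "near_bipartite G"
    and free: "\<And>x y z. \<lbrakk>distinct [x, y, z]; {x, y} \<in> edges G; {x, z} \<in> edges G\<rbrakk> \<Longrightarrow> {y, z} \<in> edges G"
  shows "ifvs G = fvs G"
proof -
  obtain S where S: "feedback_vertex_set G S" "card S = fvs G" using fvs_attained by blast
  have fin: "finite S" using S(1) sg by (auto simp: feedback_vertex_set_def simple_graph_def intro: finite_subset)
  have "{u, v} \<notin> edges G" if uv: "u \<in> S" "v \<in> S" for u v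
  proof
    assume e: "{u, v} \<in> edges G"
    have "card (S - {u}) < fvs G" using fin uv S(2) by (metis card_Diff1_less)
    then have "\<not> feedback_vertex_set G (S - {u})" using fvs_le leD by blast
    then obtain vs where c: "is_cycle (delete_verts G (S - {u})) vs"
      using S(1) by (auto simp: feedback_vertex_set_def is_forest_def)
    note vs = is_cycle_mono_delete[OF c]
    \<comment> \<open>The cycle meets \<open>S\<close> but avoids \<open>S - {u}\<close>, so it
      passes through \<open>u\<close> and misses \<open>v\<close>.\<close>
    have "u \<in> set vs" using feedback_vertex_setD[OF S(1) vs(1)] vs(2) by blast
    then obtain a b where ab: "a \<in> set vs" "b \<in> set vs" "a \<noteq> b" "a \<noteq> u" "b \<noteq> u"
      "{u, a} \<in> edges G" "{u, b} \<in> edges G"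
      using cycle_two_neighbours[OF vs(1)] by blast
    have ne: "v \<noteq> a" "v \<noteq> b" "u \<noteq> v"
      using ab vs(2) uv simple_graph_edgeD(3)[OF sg e] by auto
    have k4: "{a, b} \<in> edges G" "{v, a} \<in> edges G" "{v, b} \<in> edges G"
      using free[of u a b] free[of u v a] free[of u v b] ab ne e by auto
    obtain I where I: "indep_feedback_vertex_set G I" using nb by (auto simp: near_bipartite_def)
    have tri: "x \<in> I \<or> y \<in> I \<or> z \<in> I"
      if "distinct [x, y, z]" "{x, y} \<in> edges G" "{y, z} \<in> edges G" "{z, x} \<in> edges G" for x y z
    proof -
      have "{x, y, z} \<subseteq> verts G" using that simple_graph_edgeD[OF sg] by blast
      then have "set [x, y, z] \<inter> I \<noteq> {}"
        using that I is_cycle_3I feedback_vertex_setD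
        unfolding indep_feedback_vertex_set_def by metis
      then show ?thesis by auto
    qed
    have ind: "\<not> (x \<in> I \<and> y \<in> I)" if "{x, y} \<in> edges G" for x y
      using I that by (auto simp: indep_feedback_vertex_set_def independent_set_def)
    \<comment> \<open>An independent set contains at most one vertex of the \<open>K_4\<close>, and
      the other three form a triangle that it misses.\<close>
    show False
      using tri[of u v a] tri[of u v b] tri[of u a b] tri[of v a b]
        ind[OF e] ind[OF ab(6)] ind[OF ab(7)] ind[OF k4(1)] ind[OF k4(2)] ind[OF k4(3)] ab ne k4 e
      by (auto simp: insert_commute)
  qed
  then have "indep_feedback_vertex_set G S"
    using S(1) by (auto simp: indep_feedback_vertex_set_def independent_set_def feedback_vertex_set_def)
  then show ?thesis using S(2) ifvs_eq_fvsI by fastforce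
qed

definition nonnbrs :: "'v graph \<Rightarrow> 'v \<Rightarrow> 'v set" where
  "nonnbrs G v = {w \<in> verts G. {v, w} \<notin> edges G}"

text \<open>Without induced \<open>P\<^sub>1 + P\<^sub>2\<close> the graph is complete multipartite with parts \<open>nonnbrs G v\<close>.
  An induced forest has at most one vertex outside some part, and conversely removing all but
  a largest part and one more vertex leaves a star.\<close>

lemma ifvs_eq_fvs_P1P2_free:
  assumes sg: "simple_graph G" and nb: "near_bipartite G"
    and free: "\<And>x y z. \<lbrakk>{x, y, z} \<subseteq> verts G; distinct [x, y, z]; {x, y} \<in> edges G\<rbrakk> \<Longrightarrow>
      {x, z} \<in> edges G \<or> {y, z} \<in> edges G"
  shows "ifvs G = fvs G"
proof (cases "verts G = {}")
  case True
  then have "indep_feedback_vertex_set G {}"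
    by (auto simp: indep_feedback_vertex_set_def independent_set_def feedback_vertex_set_def
        intro: is_forest_rank)
  then show ?thesis using ifvs_eq_fvsI by fastforce
next
  case False
  let ?V = "verts G" and ?N = "nonnbrs G"
  have fin: "finite ?V" using sg by (simp add: simple_graph_def)
  have comm: "{x, y} \<in> edges G \<longleftrightarrow> {y, x} \<in> edges G" for x y by (simp add: insert_commute)
  have self: "v \<in> ?N v" if "v \<in> ?V" for v
    using that simple_graph_edgeD(3)[OF sg, of v v] by (auto simp: nonnbrs_def)
  \<comment> \<open>An edge inside this set would induce \<open>P_1 + P_2\<close> together with
    \<open>v\<close>.\<close>
  have ind: "{y, z} \<notin> edges G" if "v \<in> ?V" "y \<in> ?N v" "z \<in> ?N v" for v y z
    using that free[of y z v] comm simple_graph_edgeD(3)[OF sg] by (auto simp: nonnbrs_def)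
  have eq: "?N w = ?N v" if "v \<in> ?V" "w \<in> ?N v" for v w
    using that ind comm unfolding nonnbrs_def by blast
  have NV: "?N v \<subseteq> ?V" for v by (auto simp: nonnbrs_def)
  have forest: "\<exists>v\<in>?V. \<exists>c\<in>?V. ?V - S \<subseteq> insert c (?N v)" if S: "feedback_vertex_set G S" for S
  proof (cases "\<exists>x\<in>?V - S. \<exists>y\<in>?V - S. {x, y} \<in> edges G")
    case True
    then obtain x y where xy: "x \<in> ?V - S" "y \<in> ?V - S" "{x, y} \<in> edges G" by blast
    have ne: "x \<noteq> y" using simple_graph_edgeD(3)[OF sg xy(3)] .
    \<comment> \<open>A vertex in a third part would close a triangle with the edge between
      \<open>x\<close> and \<open>y\<close>.\<close>
    have sub: "?V - S \<subseteq> ?N x \<union> ?N y"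
    proof
      fix z assume z: "z \<in> ?V - S"
      show "z \<in> ?N x \<union> ?N y"
      proof (rule ccontr)
        assume "z \<notin> ?N x \<union> ?N y"
        then have e: "{y, z} \<in> edges G" "{z, x} \<in> edges G" using z comm by (auto simp: nonnbrs_def)
        then have "distinct [x, y, z]" using ne simple_graph_edgeD(3)[OF sg] by auto
        then have "is_cycle G [x, y, z]" using is_cycle_3I[of x y z G] e xy z by auto
        then show False using feedback_vertex_setD[OF S] xy z by fastforce
      qed
    qed
    have "?V - S \<subseteq> insert y (?N x) \<or> ?V - S \<subseteq> insert x (?N y)"
    proof (rule ccontr)
      assume "\<not> ?thesis"
      \<comment> \<open>Otherwise each of the two parts has a second vertex outside
        \<open>S\<close>, which gives a 4-cycle.\<close>
      then obtain z w where zw: "z \<in> ?V - S" "z \<notin> ?N y" "z \<noteq> x" "w \<in> ?V - S" "w \<notin> ?N x" "w \<noteq> y"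
        by blast
      then have "z \<in> ?N x" "w \<in> ?N y" using sub by auto
      have e: "{y, z} \<in> edges G" "{w, x} \<in> edges G" using zw comm by (auto simp: nonnbrs_def)
      moreover have "{z, w} \<in> edges G"
        using zw \<open>z \<in> ?N x\<close> ind[of x] eq[of x z] xy(1) by (auto simp: nonnbrs_def)
      moreover have "distinct [x, y, z, w]"
        using ne zw e \<open>{z, w} \<in> edges G\<close> simple_graph_edgeD(3)[OF sg] by auto
      ultimately have "is_cycle G [x, y, z, w]"
        using is_cycle_4I[of x y z w G] xy zw by auto
      then show False using feedback_vertex_setD[OF S] xy zw by fastforce
    qed
    then show ?thesis using xy by blast
  next
    case False
    then show ?thesis using \<open>?V \<noteq> {}\<close> unfolding nonnbrs_def by blast
  qed
  have "\<exists>v\<in>?V. card (?N v) = Max ((\<lambda>v. card (?N v)) ` ?V)"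
    using Max_in[of "(\<lambda>v. card (?N v)) ` ?V"] fin \<open>?V \<noteq> {}\<close> by fastforce
  then obtain v where v: "v \<in> ?V" and max: "\<And>w. w \<in> ?V \<Longrightarrow> card (?N w) \<le> card (?N v)"
    using fin by (metis (no_types, lifting) Max_ge finite_imageI imageI)
  have lower: "card ?V \<le> Suc (card (?N v)) + fvs G"
  proof -
    obtain S where S: "feedback_vertex_set G S" "card S = fvs G" using fvs_attained by blast
    then obtain w c where w: "w \<in> ?V" "?V - S \<subseteq> insert c (?N w)" using forest by blast
    have "card (?V - S) \<le> card (insert c (?N w))"
      using w(2) by (rule card_mono[rotated]) (use NV fin finite_subset in blast)
    also have "\<dots> \<le> Suc (card (?N w))" by (rule card_insert_le_m1) auto
    also have "\<dots> \<le> Suc (card (?N v))" using max w by simp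
    finally have "card (?V - S) \<le> Suc (card (?N v))" .
    moreover have "card (?V - S) = card ?V - card S"
      using S fin by (metis card_Diff_subset feedback_vertex_set_def finite_subset)
    ultimately show ?thesis using S by linarith
  qed
  show ?thesis
  proof (cases "?V = ?N v")
    case True
    then have "indep_feedback_vertex_set G {}"
      using ind[OF v] by (auto simp: indep_feedback_vertex_set_def independent_set_def
          feedback_vertex_set_def intro!: is_forest_rank)
    then show ?thesis using ifvs_eq_fvsI by fastforce
  next
    case ne: False
    \<comment> \<open>Near-bipartiteness enters here: \<open>I\<close> lies in the part of some
      \<open>a\<close>, the rest in the part of \<open>b\<close> plus one vertex
      \<open>c\<close>.\<close>
    obtain I where I: "indep_feedback_vertex_set G I" using nb by (auto simp: near_bipartite_def)
    then obtain b c where bc: "b \<in> ?V" "c \<in> ?V" "?V - I \<subseteq> insert c (?N b)"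
      using forest unfolding indep_feedback_vertex_set_def by blast
    obtain a where a: "a \<in> ?V" "I \<subseteq> ?N a"
    proof (cases "I = {}")
      case True
      then show ?thesis using that v by blast
    next
      case False
      then obtain a where "a \<in> I" by blast
      then show ?thesis using that[of a] I
        by (auto simp: indep_feedback_vertex_set_def independent_set_def nonnbrs_def)
    qed
    have V: "?V \<subseteq> ?N a \<union> ?N b \<union> {c}" using a bc by blast
    have "\<exists>w\<in>?V. \<exists>d. ?V - ?N v \<subseteq> insert d (?N w)"
    proof (cases "v \<in> ?N a \<or> v \<in> ?N b")
      case True
      then have "?N v = ?N a \<or> ?N v = ?N b" using eq a bc by blast
      then show ?thesis using V a bc by blast
    next
      case False
      then have "v = c" using V v by blast
      \<comment> \<open>Here \<open>v\<close> is the one vertex outside both parts. So its part and,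
        by maximality, the part of \<open>a\<close> are singletons, and \<open>a\<close> becomes the
        exceptional vertex.\<close>
      have "?N v \<subseteq> {v}"
      proof
        fix w assume "w \<in> ?N v"
        then have "?N w = ?N v" using eq v by blast
        then have "w \<notin> ?N a \<union> ?N b"
          using False eq a bc v self by blast
        then show "w \<in> {v}" using V \<open>w \<in> ?N v\<close> NV \<open>v = c\<close> by blast
      qed
      then have "card (?N v) \<le> 1" using card_mono[of "{v}" "?N v"] by simp
      then have "card (?N a) \<le> 1" using max a(1) by (meson le_trans)
      then have "?N a \<subseteq> {a}" using self[OF a(1)] card_le_Suc0_iff_eq[of "?N a"] NV fin
        by (metis One_nat_def finite_subset insertI1 subsetI singleton_iff)
      then show ?thesis using V bc \<open>v = c\<close> self[OF v] by blast
    qed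
    then obtain w d where w: "w \<in> ?V" "?V - ?N v \<subseteq> insert d (?N w)" by blast
    \<comment> \<open>If \<open>d\<close> is not a vertex outside \<open>?N v\<close>, any such
      vertex serves: exactly one must be spared to meet the bound \<open>lower\<close>.\<close>
    define c' where "c' = (if d \<in> ?V - ?N v then d else SOME x. x \<in> ?V - ?N v)"
    have "?V - ?N v \<noteq> {}" using ne NV by blast
    then have c': "c' \<in> ?V - ?N v" unfolding c'_def by (simp add: some_in_eq del: Diff_iff)
    have T: "?V - ?N v - {c'} \<subseteq> ?N w" using w(2) unfolding c'_def by (auto split: if_splits)
    let ?T = "?V - ?N v - {c'}"
    \<comment> \<open>All remaining edges join \<open>c'\<close> to the part of \<open>v\<close>;
      the rank puts this centre below its leaves.\<close>
    have "is_forest (delete_verts G ?T)"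
      by (rule is_forest_rank[where r = "\<lambda>x. if x = c' then 0 else 1"])
        (use ind[OF v] in \<open>auto split: if_splits\<close>)
    then have "indep_feedback_vertex_set G ?T"
      using T ind[OF w(1)] unfolding indep_feedback_vertex_set_def independent_set_def
        feedback_vertex_set_def by blast
    moreover have "card ?T \<le> fvs G"
    proof -
      have "card ?T = card ?V - card (?N v) - 1"
        using c' NV[of v] fin by (simp add: card_Diff_subset finite_subset)
      then show ?thesis using lower by linarith
    qed
    ultimately show ?thesis by (rule ifvs_eq_fvsI)
  qed
qed

lemma ifvs_identical_if_subgraph_path3:
  assumes K: "subgraph K (path_graph 3)" and iso: "graph_iso H K"
  shows "ifvs_identical (free_near_bipartite_class H :: 'v::infinite graph set)"
  unfolding ifvs_identical_def
proof
  fix G :: "'v graph" assume "G \<in> free_near_bipartite_class H"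
  then have sg: "simple_graph G" and nb: "near_bipartite G" and free: "graph_free H G"
    by (auto simp: free_near_bipartite_class_def)
  have Kv: "verts K \<subseteq> {0, 1, 2}" and Ke: "edges K \<subseteq> {{0, 1}, {1, 2}}" and Ks: "simple_graph K"
    using K by (auto simp: subgraph_def path_graph_def less_Suc_eq numeral_3_eq_3 numeral_2_eq_2)
  \<comment> \<open>\<open>K\<close> may lack some of the vertices \<open>0, 1, 2\<close>;
    \<open>h\<close> embeds it all the same, so only the edges of \<open>K\<close> matter
    below.\<close>
  have no: False
    if "{x, y, z} \<subseteq> verts G" "distinct [x, y, z]" "{x, z} \<notin> edges G"
      "{x, y} \<in> edges G \<longleftrightarrow> {0, 1} \<in> edges K" "{y, z} \<in> edges G \<longleftrightarrow> {1, 2} \<in> edges K" for x y z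
  proof -
    define h where "h = (\<lambda>i::nat. if i = 0 then x else if i = 1 then y else z)"
    have 02: "{0, 2} \<notin> edges K" using Ke by (auto simp: doubleton_eq_iff)
    have "embeds K G h" unfolding embeds_def
    proof (intro conjI ballI)
      show "inj_on h (verts K)" using Kv that(2) by (auto simp: h_def inj_on_def)
      show "h ` verts K \<subseteq> verts G" using Kv that(1) by (auto simp: h_def)
      fix u v assume "u \<in> verts K" "v \<in> verts K"
      then have "u \<in> {0, 1, 2}" "v \<in> {0, 1, 2}" using Kv by auto
      then show "{u, v} \<in> edges K \<longleftrightarrow> {h u, h v} \<in> edges G"
        using that 02 simple_graph_edgeD(3)[OF sg, of x x] simple_graph_edgeD(3)[OF sg, of y y]
          simple_graph_edgeD(3)[OF sg, of z z] simple_graph_edgeD(3)[OF Ks, of u u]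
        by (auto simp: h_def insert_commute)
    qed
    then show False using free graph_iso_embeds[OF iso] embeds_comp unfolding graph_free_iff by blast
  qed
  have comm: "{x, y} \<in> edges G \<longleftrightarrow> {y, x} \<in> edges G" for x y by (simp add: insert_commute)
  \<comment> \<open>The edges of \<open>K\<close> decide between \<open>3P_1\<close>,
    \<open>P_3\<close> and, in the last two cases, \<open>P_1 + P_2\<close>.\<close>
  consider "{0, 1} \<notin> edges K" "{1, 2} \<notin> edges K" | "{0, 1} \<in> edges K" "{1, 2} \<in> edges K"
    | "{0, 1} \<in> edges K" "{1, 2} \<notin> edges K" | "{0, 1} \<notin> edges K" "{1, 2} \<in> edges K" by blast
  then show "ifvs G = fvs G"
  proof cases
    case 1
    show ?thesis using no 1 by (intro ifvs_eq_fvs_3P1_free[OF sg nb]) metis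
  next
    case 2
    have "{y, z} \<in> edges G"
      if "distinct [x, y, z]" "{x, y} \<in> edges G" "{x, z} \<in> edges G" for x y z
      using no[of y x z] 2 that comm simple_graph_edgeD[OF sg] by auto
    then show ?thesis by (intro ifvs_eq_fvs_P3_free[OF sg nb]) blast
  next
    case 3
    have "{x, z} \<in> edges G \<or> {y, z} \<in> edges G"
      if "{x, y, z} \<subseteq> verts G" "distinct [x, y, z]" "{x, y} \<in> edges G" for x y z
      using no[of x y z] 3 that by auto
    then show ?thesis by (intro ifvs_eq_fvs_P1P2_free[OF sg nb]) blast
  next
    case 4
    have "{x, z} \<in> edges G \<or> {y, z} \<in> edges G"
      if "{x, y, z} \<subseteq> verts G" "distinct [x, y, z]" "{x, y} \<in> edges G" for x y z
      using no[of z x y] 4 that comm by auto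
    then show ?thesis by (intro ifvs_eq_fvs_P1P2_free[OF sg nb]) blast
  qed
qed

section \<open>Graphs of large girth\<close>

text \<open>Two adjacent hubs \<open>(4, 0)\<close> and \<open>(5, 0)\<close>; rows \<open>0, 1\<close> of \<open>n\<close> vertices close up to
  cycles through the first hub, rows \<open>2, 3\<close> to cycles through the second one.\<close>

definition hub_rel :: "nat \<Rightarrow> nat \<times> nat \<Rightarrow> nat \<times> nat \<Rightarrow> bool" where
  "hub_rel n p q \<longleftrightarrow> fst p = fst q \<and> snd q = Suc (snd p) \<or> p = (4, 0) \<and> q = (5, 0) \<or>
     p = (4 + fst q div 2, 0) \<and> fst q < 4 \<and> (snd q = 0 \<or> Suc (snd q) = n)"

definition hub_graph :: "nat \<Rightarrow> (nat \<times> nat) graph" where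
  "hub_graph n = rel_graph ({..<4} \<times> {..<n} \<union> {(4, 0), (5, 0)}) (hub_rel n)"

lemma verts_hub_graph [simp]:
  "verts (hub_graph n) = {..<4} \<times> {..<n} \<union> {(4, 0), (5, 0)}"
  by (simp add: hub_graph_def)

lemma simple_hub_graph: "simple_graph (hub_graph n)"
  unfolding hub_graph_def by (rule simple_rel_graph) auto

text \<open>Without one vertex, each row falls into at most two paths that hang from its hub, and
  the hubs are joined by a single edge.\<close>

lemma is_forest_hub_graph_delete:
  assumes "\<And>i. i < 4 \<Longrightarrow> J i < n" "2 \<le> n"
  shows "is_forest (delete_verts (hub_graph n) ((\<lambda>i. (i, J i)) ` {..<4}))" (is "is_forest ?G")
proof -
  \<comment> \<open>\<open>r\<close> increases along these paths away from the hub, above the ranks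
    \<open>0\<close> and \<open>1\<close> of the hubs; \<open>p\<close> is the next vertex towards
    the hub.\<close>
  define r where "r = (\<lambda>(i, j). if 4 \<le> i then i - 4 else 2 + (if j < J i then j else n - j))"
  define p where "p = (\<lambda>(i, j). if 4 \<le> i then (4, 0) else if j < J i
      then (if j = 0 then (4 + i div 2, 0) else (i, j - 1))
      else (if Suc j = n then (4 + i div 2, 0) else (i, Suc j)))"
  have "y = p x" if "x \<in> verts ?G" "y \<in> verts ?G" "{x, y} \<in> edges ?G" "r y \<le> r x" for x y
  proof -
    obtain i j i' j' where xy: "x = (i, j)" "y = (i', j')" by fastforce
    have R: "hub_rel n x y \<or> hub_rel n y x" using that(3) by (auto simp: hub_graph_def)
    have "i < 4 \<Longrightarrow> j \<noteq> J i \<and> j < n" using that(1) by (auto simp: xy)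
    then consider "4 \<le> i" | "i < 4" "j < J i" "J i < n" | "i < 4" "J i < j" "J i < n" "j < n"
      using assms(1)[of i] by (metis linorder_neqE_nat not_le)
    then show ?thesis
    proof cases
      case 1
      then show ?thesis using R that assms(2) unfolding xy r_def p_def hub_rel_def
        by (auto split: if_splits)
    next
      case 2
      then show ?thesis using R that assms(2) unfolding xy r_def p_def hub_rel_def
        by (auto split: if_splits)
    next
      case 3
      then show ?thesis using R that assms(2) unfolding xy r_def p_def hub_rel_def
        by (auto split: if_splits)
    qed
  qed
  then show ?thesis by (rule is_forest_parent)
qed

lemma is_cycle_hub_graph:
  assumes "i < 4" "2 \<le> n"
  shows "is_cycle (hub_graph n) ((4 + i div 2, 0) # map (Pair i) [0..<n])" (is "is_cycle _ ?vs")
  unfolding is_cycle_def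
proof (intro conjI allI impI)
  have h: "i div 2 = 0 \<or> i div 2 = 1" using assms(1) by linarith
  show "set ?vs \<subseteq> verts (hub_graph n)" using assms h by auto
  show "distinct ?vs" using assms by (auto simp: distinct_map inj_on_def)
  have nth: "?vs ! Suc j = (i, j)" if "j < n" for j using that by simp
  fix k assume k: "k < length ?vs"
  show "{?vs ! k, ?vs ! (Suc k mod length ?vs)} \<in> edges (hub_graph n)"
  proof (cases k)
    case 0
    then have "?vs ! k = (4 + i div 2, 0)" "?vs ! (Suc k mod length ?vs) = (i, 0)"
      using assms nth[of 0] by auto
    then show ?thesis using assms h by (auto simp: hub_graph_def hub_rel_def)
  next
    case (Suc j)
    show ?thesis
    proof (cases "Suc j = n")
      case True
      then have "?vs ! k = (i, j)" "?vs ! (Suc k mod length ?vs) = (4 + i div 2, 0)"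
        using Suc nth[of j] by auto
      then show ?thesis using assms h True by (auto simp: hub_graph_def hub_rel_def)
    next
      case False
      then have "Suc j < n" using k Suc by simp
      then have "?vs ! k = (i, j)" "?vs ! (Suc k mod length ?vs) = (i, Suc j)"
        using Suc nth[of j] nth[of "Suc j"] by auto
      then show ?thesis using assms \<open>Suc j < n\<close> by (auto simp: hub_graph_def hub_rel_def)
    qed
  qed
qed (use assms in auto)

text \<open>A cycle on fewer than \<open>n\<close> vertices misses a vertex of every row, so it
  would survive in the forest left by deleting those.\<close>

lemma hub_graph_girth:
  assumes "is_cycle (hub_graph n) vs" "2 \<le> n"
  shows "n \<le> length vs"
proof (rule ccontr)
  assume less: "\<not> n \<le> length vs"
  have "\<exists>j<n. (i, j) \<notin> set vs" for i
  proof (rule ccontr)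
    assume "\<not> ?thesis"
    then have "Pair i ` {..<n} \<subseteq> set vs" by auto
    then have "card (Pair i ` {..<n}) \<le> card (set vs)" by (rule card_mono[rotated]) simp
    moreover have "card (Pair i ` {..<n}) = n" by (subst card_image) (auto simp: inj_on_def)
    ultimately show False using less card_length[of vs] by simp
  qed
  then obtain J where J: "\<And>i. J i < n" "\<And>i. (i, J i) \<notin> set vs" by metis
  have "is_cycle (delete_verts (hub_graph n) ((\<lambda>i. (i, J i)) ` {..<4})) vs"
    using J(2) by (intro is_cycle_delete_verts[OF assms(1)]) auto
  then show False using is_forest_hub_graph_delete[of J n] J(1) assms(2)
    by (auto simp: is_forest_def)
qed

lemma near_bipartite_hub_graph:
  assumes "2 \<le> n"
  shows "near_bipartite (hub_graph n)"
proof -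
  have "is_forest (delete_verts (hub_graph n) ((\<lambda>i. (i, 1)) ` {..<4}))"
    by (rule is_forest_hub_graph_delete) (use assms in auto)
  moreover have "independent_set (hub_graph n) ((\<lambda>i. (i, 1)) ` {..<4})"
    using assms by (auto simp: independent_set_def hub_graph_def hub_rel_def)
  ultimately show ?thesis by (rule near_bipartiteI)
qed

lemma fvs_hub_graph_le: "fvs (hub_graph n) \<le> 2"
proof -
  have "feedback_vertex_set (hub_graph n) {(4, 0), (5, 0)}"
    unfolding feedback_vertex_set_def
  proof
    show "is_forest (delete_verts (hub_graph n) {(4, 0), (5, 0)})"
      by (rule is_forest_rank[where r = snd]) (auto simp: hub_graph_def hub_rel_def)
  qed simp
  then show ?thesis using fvs_le by fastforce
qed

text \<open>Of the two adjacent hubs one is missing in an independent feedback vertex set; it then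
  contains a vertex of each of the two rows of that hub, and one of a cycle of the other.\<close>

lemma ifvs_hub_graph_ge:
  assumes n: "2 \<le> n"
  shows "3 \<le> ifvs (hub_graph n)"
proof -
  let ?G = "hub_graph n"
  obtain S where S: "feedback_vertex_set ?G S" "independent_set ?G S" "card S = ifvs ?G"
    using ifvs_attained[OF near_bipartite_hub_graph[OF n]]
    by (auto simp: indep_feedback_vertex_set_def)
  have "finite S" using S(1) simple_hub_graph[of n]
    by (auto simp: feedback_vertex_set_def simple_graph_def intro: finite_subset)
  have hit: "(4 + i div 2, 0) \<in> S \<or> (\<exists>j. (i, j) \<in> S)" if "i < 4" for i
    using feedback_vertex_setD[OF S(1) is_cycle_hub_graph[OF that n]] by auto
  have "{(4, 0), (5, 0)} \<in> edges ?G" by (simp add: hub_graph_def hub_rel_def)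
  then have "(4, 0) \<notin> S \<or> (5, 0) \<notin> S" using S(2) unfolding independent_set_def by blast
  then have "\<exists>a\<in>S. \<exists>b\<in>S. \<exists>c\<in>S. distinct [a, b, c]"
  proof
    assume "(4, 0) \<notin> S"
    then obtain j k where "(0, j) \<in> S" "(1, k) \<in> S" using hit[of 0] hit[of 1] by auto
    moreover obtain m l where "(m, l) \<in> S" "m \<ge> 2" using hit[of 2] by auto
    moreover have "distinct [(0, j), (1, k), (m, l)]" using \<open>m \<ge> 2\<close> by auto
    ultimately show ?thesis by blast
  next
    assume "(5, 0) \<notin> S"
    then obtain j k where "(2, j) \<in> S" "(3, k) \<in> S" using hit[of 2] hit[of 3] by auto
    moreover obtain m l where "(m, l) \<in> S" "m = 0 \<or> m = 4" using hit[of 0] by auto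
    moreover have "distinct [(2, j), (3, k), (m, l)]" using \<open>m = 0 \<or> m = 4\<close> by auto
    ultimately show ?thesis by blast
  qed
  then obtain a b c where "{a, b, c} \<subseteq> S" "distinct [a, b, c]" by blast
  then have "card {a, b, c} \<le> card S" using \<open>finite S\<close> by (intro card_mono)
  moreover have "card {a, b, c} = 3" using \<open>distinct [a, b, c]\<close> by simp
  ultimately show ?thesis using S(3) by simp
qed

lemma not_ifvs_identical_if_cycle:
  assumes "simple_graph H" "\<not> is_forest H"
  shows "\<not> ifvs_identical (free_near_bipartite_class H :: 'v::infinite graph set)"
proof -
  obtain vs where vs: "is_cycle H vs" using assms(2) by (auto simp: is_forest_def)
  \<comment> \<open>Exceeds the length of every cycle of \<open>H\<close>, so that no such cycle
    embeds; the summand also ensures \<open>2 \<le> n\<close>.\<close>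
  define n where "n = card (verts H) + 2"
  have "card (set vs) \<le> card (verts H)"
    using vs assms(1) by (auto simp: is_cycle_def simple_graph_def intro: card_mono)
  then have len: "length vs < n"
    using vs by (auto simp: is_cycle_def distinct_card n_def)
  have "graph_free H (hub_graph n)"
    unfolding graph_free_iff
  proof
    assume "\<exists>h. embeds H (hub_graph n) h"
    then obtain h where "embeds H (hub_graph n) h" by blast
    then have "is_cycle (hub_graph n) (map h vs)"
      by (intro is_cycle_map[OF vs]) (auto simp: embeds_def)
    then show False using hub_graph_girth[of n "map h vs"] len by (simp add: n_def)
  qed
  moreover have "fvs (hub_graph n) < ifvs (hub_graph n)"
    using fvs_hub_graph_le[of n] ifvs_hub_graph_ge[of n] by (simp add: n_def)
  ultimately show ?thesis
    by (intro not_ifvs_identicalI[OF simple_hub_graph near_bipartite_hub_graph])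
      (auto simp: n_def)
qed

section \<open>Linear forests on four vertices\<close>

text \<open>The first three conditions say that \<open>a, b, c, d\<close>, in this order, induce a
  linear forest; the last one leaves \<open>P\<^sub>4\<close>, \<open>P\<^sub>3 + P\<^sub>1\<close> and \<open>P\<^sub>2 + 2P\<^sub>1\<close>
  and excludes \<open>4P\<^sub>1\<close> and \<open>2P\<^sub>2\<close>.\<close>

definition linear4 :: "'v graph \<Rightarrow> 'v \<Rightarrow> 'v \<Rightarrow> 'v \<Rightarrow> 'v \<Rightarrow> bool" where
  "linear4 G a b c d \<longleftrightarrow> {a, b, c, d} \<subseteq> verts G \<and> distinct [a, b, c, d] \<and>
     {a, c} \<notin> edges G \<and> {a, d} \<notin> edges G \<and> {b, d} \<notin> edges G"

definition unbalanced :: "'v graph \<Rightarrow> 'v \<Rightarrow> 'v \<Rightarrow> 'v \<Rightarrow> 'v \<Rightarrow> bool" where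
  "unbalanced G a b c d \<longleftrightarrow> {b, c} \<in> edges G \<or> ({a, b} \<in> edges G \<longleftrightarrow> {c, d} \<notin> edges G)"

lemma embeds_linear4:
  assumes "embeds H G h" "linear4 H a b c d"
  shows "linear4 G (h a) (h b) (h c) (h d)"
    "unbalanced G (h a) (h b) (h c) (h d) \<longleftrightarrow> unbalanced H a b c d"
  using assms unfolding embeds_def linear4_def unbalanced_def
  by (auto simp: inj_on_eq_iff)

text \<open>An induced copy of \<open>H\<close> would carry \<open>a, b, c, d\<close> to a quadruple
  of the same kind, but those of \<open>G\<close> are all of the opposite kind.\<close>

lemma graph_free_linear4:
  assumes "linear4 H a b c d"
    and "\<And>w x y z. linear4 G w x y z \<Longrightarrow> unbalanced G w x y z \<longleftrightarrow> \<not> unbalanced H a b c d"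
  shows "graph_free H G"
  unfolding graph_free_iff
proof
  assume "\<exists>h. embeds H G h"
  then obtain h where "embeds H G h" by blast
  from embeds_linear4[OF this assms(1)] show False using assms(2) by metis
qed

text \<open>The cycle \<open>1, 2, 3, 4\<close> with pendant vertices \<open>5\<close> at \<open>1\<close> and \<open>6\<close> at \<open>2\<close>, joined
  to the vertex \<open>0\<close>.\<close>

definition cone_graph :: "nat graph" where
  "cone_graph = rel_graph {0, 1, 2, 3, 4, 5, 6}
     (\<lambda>x y. x = 0 \<or> (x, y) \<in> {(1, 2), (2, 3), (3, 4), (1, 4), (1, 5), (2, 6)})"

lemma simple_cone_graph: "simple_graph cone_graph"
  unfolding cone_graph_def by (rule simple_rel_graph) auto

text \<open>The edges \<open>1 5\<close>, \<open>2 6\<close> and \<open>3 4\<close> cover all vertices other than \<open>0\<close>, which excludes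
  \<open>4P\<^sub>1\<close>.\<close>

lemma cone_graph_linear4:
  assumes "linear4 cone_graph w x y z"
  shows "unbalanced cone_graph w x y z"
proof -
  let ?V = "{1, 2, 3, 4, 5, 6 :: nat}"
  define e where "e = (\<lambda>u v. {u, v} \<in> edges cone_graph)"
  have sym: "e u v \<longleftrightarrow> e v u" for u v by (simp add: e_def insert_commute)
  \<comment> \<open>\<open>0\<close> is adjacent to all other vertices, so a vertex with a
    non-neighbour differs from \<open>0\<close>.\<close>
  have V: "v \<in> ?V" if "v \<in> verts cone_graph" "u \<in> verts cone_graph" "v \<noteq> u" "\<not> e v u" for u v
    using that unfolding e_def cone_graph_def rel_graph_simps by blast
  have lt: "{w, x, y, z} \<subseteq> verts cone_graph" "distinct [w, x, y, z]"
    and ne: "\<not> e w y" "\<not> e w z" "\<not> e x z"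
    using assms unfolding linear4_def e_def by simp_all
  have wxyz: "w \<in> ?V" "x \<in> ?V" "y \<in> ?V" "z \<in> ?V"
    using lt ne V[of w y] V[of x z] V[of y w] V[of z w] sym by auto
  have "\<not> (\<not> e x y \<and> \<not> e w x \<and> \<not> e y z)"
  proof
    assume n: "\<not> e x y \<and> \<not> e w x \<and> \<not> e y z"
    \<comment> \<open>\<open>c\<close> numbers the three covering edges; four pairwise non-adjacent
      vertices would need four values.\<close>
    define c where "c = (\<lambda>v::nat. if v \<in> {1, 5} then 0 else if v \<in> {2, 6} then 1 else 2 :: nat)"
    have "c u \<noteq> c v" if "u \<in> ?V" "v \<in> ?V" "u \<noteq> v" "\<not> e u v" for u v
      using that unfolding e_def cone_graph_def rel_graph_simps
      by (elim insertE emptyE) (simp_all add: c_def)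
    then have "distinct [c w, c x, c y, c z]" using wxyz lt(2) ne n by simp
    moreover have "c v \<le> 2" for v by (simp add: c_def)
    ultimately show False
      using \<open>c w \<le> 2\<close> \<open>c x \<le> 2\<close> \<open>c y \<le> 2\<close> \<open>c z \<le> 2\<close> by simp
  qed
  moreover have "\<not> (\<not> e x y \<and> e w x \<and> e y z)"
  proof
    assume n: "\<not> e x y \<and> e w x \<and> e y z"
    \<comment> \<open>Both orientations of the edges away from \<open>0\<close>, so that excluding
      \<open>2P_2\<close> becomes a finite check over pairs of edges.\<close>
    define D where "D = {(1, 2 :: nat), (2, 3), (3, 4), (1, 4), (1, 5), (2, 6),
      (2, 1), (3, 2), (4, 3), (4, 1), (5, 1), (6 :: nat, 2)}"
    have E: "e u v \<longleftrightarrow> (u, v) \<in> D" if "u \<in> ?V" "v \<in> ?V" for u v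
      using that unfolding e_def cone_graph_def rel_graph_simps D_def
      by (elim insertE emptyE) simp_all
    have "(w, x) \<in> D" "(y, z) \<in> D" "(x, y) \<notin> D" "(w, y) \<notin> D" "(w, z) \<notin> D" "(x, z) \<notin> D"
      using n ne E[OF wxyz(1,2)] E[OF wxyz(3,4)] E[OF wxyz(2,3)] E[OF wxyz(1,3)]
        E[OF wxyz(1,4)] E[OF wxyz(2,4)] by simp_all
    then show False using lt(2) unfolding D_def
      by (elim insertE emptyE; elim Pair_inject; hypsubst; simp)
  qed
  ultimately show ?thesis unfolding unbalanced_def e_def by blast
qed

text \<open>\<open>{1, 3, 6}\<close> is one side of the bipartite graph without \<open>0\<close>;
  the other side forms a star with centre \<open>0\<close>.\<close>

lemma near_bipartite_cone_graph: "near_bipartite cone_graph"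
proof -
  have "is_forest (delete_verts cone_graph {1, 3, 6})"
    by (rule is_forest_parent[where r = id and p = "\<lambda>v. 0"]) (auto simp: cone_graph_def)
  moreover have "independent_set cone_graph {1, 3, 6}"
    by (auto simp: independent_set_def cone_graph_def)
  ultimately show ?thesis by (rule near_bipartiteI)
qed

lemma fvs_cone_graph_le: "fvs cone_graph \<le> 2"
proof -
  \<comment> \<open>The path \<open>4, 3, 2, 6\<close> and the isolated vertex \<open>5\<close>
    remain.\<close>
  have "is_forest (delete_verts cone_graph {0, 1})"
    by (rule is_forest_parent[where r = id and p = "\<lambda>v. if v = 4 then 3 else 2"]) (auto simp: cone_graph_def)
  then have "feedback_vertex_set cone_graph {0, 1}" by (simp add: feedback_vertex_set_def cone_graph_def)
  then show ?thesis using fvs_le by fastforce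
qed

text \<open>An independent feedback vertex set avoids \<open>0\<close> because of the 4-cycle, hence is a side of
  the bipartite graph that remains without \<open>0\<close>.\<close>

lemma ifvs_cone_graph_ge: "3 \<le> ifvs cone_graph"
proof -
  let ?G = cone_graph
  obtain S where S: "feedback_vertex_set ?G S" "independent_set ?G S" "card S = ifvs ?G"
    using ifvs_attained[OF near_bipartite_cone_graph]
    by (auto simp: indep_feedback_vertex_set_def)
  have "finite S" using S(1) simple_cone_graph
    by (auto simp: feedback_vertex_set_def simple_graph_def intro: finite_subset)
  have ind: "x \<notin> S \<or> y \<notin> S" if "{x, y} \<in> edges ?G" for x y
    using S(2) that by (auto simp: independent_set_def)
  have "is_cycle ?G [1, 2, 3, 4]" by (rule is_cycle_4I) (auto simp: cone_graph_def)
  then have "1 \<in> S \<or> 2 \<in> S \<or> 3 \<in> S \<or> 4 \<in> S" using feedback_vertex_setD[OF S(1)] by fastforce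
  moreover have "{0, 1} \<in> edges ?G" "{0, 2} \<in> edges ?G" "{0, 3} \<in> edges ?G" "{0, 4} \<in> edges ?G"
    by (auto simp: cone_graph_def)
  ultimately have 0: "0 \<notin> S" using ind by metis
  have cover: "x \<in> S \<or> y \<in> S" if "{x, y} \<in> edges ?G" "x \<noteq> 0" "y \<noteq> 0" for x y
  proof -
    have "is_cycle ?G [0, x, y]"
      using that by (intro is_cycle_3I) (auto simp: cone_graph_def)
    then show ?thesis using feedback_vertex_setD[OF S(1)] 0 by fastforce
  qed
  have e: "{1, 2} \<in> edges ?G" "{2, 3} \<in> edges ?G" "{1, 4} \<in> edges ?G" "{1, 5} \<in> edges ?G"
    "{2, 6} \<in> edges ?G" by (auto simp: cone_graph_def)
  \<comment> \<open>Exactly one of \<open>1\<close> and \<open>2\<close> lies in \<open>S\<close>;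
    covering forces in all neighbours of the other one except \<open>0\<close>.\<close>
  have "{1, 3, 6} \<subseteq> S \<or> {2, 4, 5} \<subseteq> S"
    using ind[OF e(1)] cover[OF e(1)] cover[OF e(2)] cover[OF e(3)] cover[OF e(4)] cover[OF e(5)]
    by auto
  then show ?thesis
    using card_mono[OF \<open>finite S\<close>, of "{1, 3, 6}"] card_mono[OF \<open>finite S\<close>, of "{2, 4, 5}"] S(3)
    by auto
qed

text \<open>The join of the matching \<open>0 1, 2 3\<close> with the independent set \<open>{4, 5, 6, 7}\<close>.\<close>

definition join_graph :: "nat graph" where
  "join_graph = rel_graph {..<8}
     (\<lambda>x y. x < 4 \<and> (4 \<le> y \<or> x div 2 = y div 2))"

lemma simple_join_graph: "simple_graph join_graph"
  unfolding join_graph_def by (rule simple_rel_graph) auto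

text \<open>The three non-adjacent pairs connect the four vertices, so all lie on one side of the
  join. On the independent side they induce \<open>4P_1\<close>, on the other they are the ends of
  both matching edges.\<close>

lemma join_graph_linear4:
  assumes "linear4 join_graph w x y z"
  shows "\<not> unbalanced join_graph w x y z"
proof -
  let ?E = "\<lambda>u v. {u, v} \<in> edges join_graph"
  have E: "?E u v \<longleftrightarrow> u \<noteq> v \<and> ((u < 4) \<noteq> (v < 4) \<or> u < 4 \<and> u div 2 = v div 2)"
    if "u \<in> {w, x, y, z}" "v \<in> {w, x, y, z}" for u v
  proof -
    have "u \<in> verts join_graph" "v \<in> verts join_graph" using assms that by (auto simp: linear4_def)
    then show ?thesis by (auto simp: join_graph_def)
  qed
  have ne: "distinct [w, x, y, z]" "\<not> ?E w y" "\<not> ?E w z" "\<not> ?E x z"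
    using assms by (simp_all add: linear4_def)
  have "((u < 4) = (v < 4)) \<and> (u < 4 \<longrightarrow> u div 2 \<noteq> v div 2)"
    if "u \<in> {w, x, y, z}" "v \<in> {w, x, y, z}" "u \<noteq> v" "\<not> ?E u v" for u v
    using E that by blast
  from this[of w y] this[of w z] this[of x z]
  have side: "(w < 4) = (y < 4)" "(w < 4) = (z < 4)" "(x < 4) = (z < 4)"
    and "w < 4 \<Longrightarrow> w div 2 \<noteq> y div 2 \<and> w div 2 \<noteq> z div 2 \<and> x div 2 \<noteq> z div 2"
    using ne by simp_all
  moreover have "v div 2 = 0 \<or> v div 2 = 1" if "v < 4" for v :: nat using that by presburger
  ultimately have "w < 4 \<Longrightarrow> w div 2 = x div 2 \<and> y div 2 = z div 2 \<and> x div 2 \<noteq> y div 2"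
    by metis
  then show ?thesis using side ne(1) E[of x y] E[of w x] E[of y z] unfolding unbalanced_def by auto
qed

lemma near_bipartite_join_graph: "near_bipartite join_graph"
proof -
  have "is_forest (delete_verts join_graph {4..<8})" (is "is_forest ?G")
  proof (rule is_forest_parent[where r = id and p = "\<lambda>v. v - 1"])
    fix x y
    assume "x \<in> verts ?G" "y \<in> verts ?G" "{x, y} \<in> edges ?G" "id y \<le> id x"
    then show "y = x - 1" by (simp add: join_graph_def) presburger
  qed
  moreover have "independent_set join_graph {4..<8}"
    by (auto simp: independent_set_def join_graph_def)
  ultimately show ?thesis by (rule near_bipartiteI)
qed

lemma fvs_join_graph_le: "fvs join_graph \<le> 3"
proof -
  have "is_forest (delete_verts join_graph {1..<4})" (is "is_forest ?G")
  proof (rule is_forest_parent[where r = id and p = "\<lambda>v. 0"])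
    fix x y
    assume "x \<in> verts ?G" "y \<in> verts ?G" "{x, y} \<in> edges ?G" "id y \<le> id x"
    then show "y = 0" by (simp add: join_graph_def)
  qed
  then have "feedback_vertex_set join_graph {1..<4}" by (auto simp: feedback_vertex_set_def join_graph_def)
  then show ?thesis using fvs_le by fastforce
qed

text \<open>An end of each matching edge is missing from \<open>S\<close>, and these two form a
  4-cycle with \<open>4\<close> and \<open>5\<close>. So \<open>S\<close> meets the independent side
  and avoids \<open>0\<close> and \<open>1\<close>; the triangles on the edge between these force
  the whole side into \<open>S\<close>.\<close>

lemma ifvs_join_graph_ge: "4 \<le> ifvs join_graph"
proof -
  let ?G = join_graph
  obtain S where S: "feedback_vertex_set ?G S" "independent_set ?G S" "card S = ifvs ?G"
    using ifvs_attained[OF near_bipartite_join_graph]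
    by (auto simp: indep_feedback_vertex_set_def)
  have "finite S" using S(1) simple_join_graph
    by (auto simp: feedback_vertex_set_def simple_graph_def intro: finite_subset)
  have ind: "x \<notin> S \<or> y \<notin> S" if "{x, y} \<in> edges ?G" for x y
    using S(2) that by (auto simp: independent_set_def)
  have "{0, 1} \<in> edges ?G" "{2, 3} \<in> edges ?G" by (auto simp: join_graph_def)
  then have "0 \<notin> S \<or> 1 \<notin> S" "2 \<notin> S \<or> 3 \<notin> S" using ind by simp_all
  then obtain p q where pq: "p \<in> {0, 1}" "q \<in> {2, 3}" "p \<notin> S" "q \<notin> S" by blast
  have "is_cycle ?G [p, 4, q, 5]"
    using pq(1,2) by (intro is_cycle_4I) (auto simp: join_graph_def)
  then obtain a where a: "a \<in> S" "a \<in> {4, 5}" using feedback_vertex_setD[OF S(1)] pq by fastforce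
  have "{0, a} \<in> edges ?G" "{1, a} \<in> edges ?G" using a(2) by (auto simp: join_graph_def)
  then have 01: "0 \<notin> S" "1 \<notin> S" using ind a(1) by blast+
  have "x \<in> S" if "x \<in> {4, 5, 6, 7}" for x
  proof -
    have "is_cycle ?G [0, 1, x]" using that by (intro is_cycle_3I) (auto simp: join_graph_def)
    then show ?thesis using feedback_vertex_setD[OF S(1)] 01 by fastforce
  qed
  then have "card {4, 5, 6, 7::nat} \<le> card S" using \<open>finite S\<close> by (intro card_mono) auto
  then show ?thesis using S(3) by simp
qed

lemma not_ifvs_identical_if_linear4:
  assumes "linear4 H a b c d"
  shows "\<not> ifvs_identical (free_near_bipartite_class H :: 'v::infinite graph set)"
proof (cases "unbalanced H a b c d")
  case True
  then have "graph_free H join_graph"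
    using join_graph_linear4 by (intro graph_free_linear4[OF assms]) blast
  moreover have "fvs join_graph < ifvs join_graph"
    using fvs_join_graph_le ifvs_join_graph_ge by linarith
  ultimately show ?thesis
    by (rule not_ifvs_identicalI[OF simple_join_graph near_bipartite_join_graph])
next
  case False
  then have "graph_free H cone_graph"
    using cone_graph_linear4 by (intro graph_free_linear4[OF assms]) blast
  moreover have "fvs cone_graph < ifvs cone_graph"
    using fvs_cone_graph_le ifvs_cone_graph_ge by linarith
  ultimately show ?thesis
    by (rule not_ifvs_identicalI[OF simple_cone_graph near_bipartite_cone_graph])
qed

section \<open>Small forests\<close>

lemma forest_no_triangle:
  assumes "simple_graph H" "is_forest H" "{a, b} \<in> edges H" "{b, c} \<in> edges H"
  shows "{a, c} \<notin> edges H"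
proof
  assume ac: "{a, c} \<in> edges H"
  then have "is_cycle H [a, b, c]"
    using assms simple_graph_edgeD[OF assms(1)] by (intro is_cycle_3I) (auto simp: insert_commute)
  then show False using assms(2) by (auto simp: is_forest_def)
qed

lemma forest_four_vertices:
  assumes sg: "simple_graph H" and fo: "is_forest H"
    and V: "{a, b, c, d} \<subseteq> verts H" "distinct [a, b, c, d]"
    and no: "\<And>w x y z. \<not> linear4 H w x y z"
  obtains x p q r where "{x, p, q, r} = {a, b, c, d}" "distinct [x, p, q, r]"
    "{x, p} \<in> edges H" "{x, q} \<in> edges H" "{x, r} \<in> edges H"
proof -
  have comm: "{x, y} \<in> edges H \<longleftrightarrow> {y, x} \<in> edges H" for x y by (simp add: insert_commute)
  note tri = forest_no_triangle[OF sg fo]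
  have n: "{w, y} \<in> edges H \<or> {w, z} \<in> edges H \<or> {x, z} \<in> edges H"
    if "{w, x, y, z} \<subseteq> {a, b, c, d}" "distinct [w, x, y, z]" for w x y z
    using no[of w x y z] that V by (auto simp: linear4_def)
  have c4: "\<not> ({w, x} \<in> edges H \<and> {x, y} \<in> edges H \<and> {y, z} \<in> edges H \<and> {z, w} \<in> edges H)"
    if "{w, x, y, z} \<subseteq> {a, b, c, d}" "distinct [w, x, y, z]" for w x y z
    using is_cycle_4I[of w x y z H] that V fo unfolding is_forest_def by blast
  have neq: "a \<noteq> b" "a \<noteq> c" "a \<noteq> d" "b \<noteq> c" "b \<noteq> d" "c \<noteq> d"
    "b \<noteq> a" "c \<noteq> a" "d \<noteq> a" "c \<noteq> b" "d \<noteq> b" "d \<noteq> c" using V(2) by auto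
  \<comment> \<open>A propositional check over six possible edges: reversal preserves
    \<open>linear4\<close>, so twelve orderings suffice, next to the four triangles and three
    4-cycles.\<close>
  have "{a, b} \<in> edges H \<and> {a, c} \<in> edges H \<and> {a, d} \<in> edges H \<or>
    {b, a} \<in> edges H \<and> {b, c} \<in> edges H \<and> {b, d} \<in> edges H \<or>
    {c, a} \<in> edges H \<and> {c, b} \<in> edges H \<and> {c, d} \<in> edges H \<or>
    {d, a} \<in> edges H \<and> {d, b} \<in> edges H \<and> {d, c} \<in> edges H"
    using n[of a b c d] n[of a b d c] n[of a c b d] n[of a c d b] n[of a d b c] n[of a d c b]
      n[of b a c d] n[of b a d c] n[of b c a d] n[of b d a c] n[of c a b d] n[of c b a d]
      tri[of a b c] tri[of a b d] tri[of a c d] tri[of b c d] neq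
      c4[of a b c d] c4[of a b d c] c4[of a c b d]
      comm[of b a] comm[of c a] comm[of d a] comm[of c b] comm[of d b] comm[of d c]
    by simp argo
  then show ?thesis
    using that[of a b c d] that[of b a c d] that[of c a b d] that[of d a b c] V(2)
    by (auto simp: insert_commute)
qed

lemma linear4_if_forest:
  assumes sg: "simple_graph H" and fo: "is_forest H" and card: "4 \<le> card (verts H)"
    and star: "\<not> graph_iso H (star_graph 3)"
  shows "\<exists>a b c d. linear4 H a b c d"
proof (rule ccontr)
  assume "\<not> ?thesis"
  then have no: "\<not> linear4 H w x y z" for w x y z by blast
  have comm: "{x, y} \<in> edges H \<longleftrightarrow> {y, x} \<in> edges H" for x y by (simp add: insert_commute)
  obtain A where A: "A \<subseteq> verts H" "card A = 4" using card by (metis obtain_subset_with_card_n)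
  then obtain a b c d where "A = {a, b, c, d}" "distinct [a, b, c, d]"
    by (auto simp: card_Suc_eq numeral_eq_Suc)
  then obtain x p q r where x: "{x, p, q, r} = A" "distinct [x, p, q, r]"
    "{x, p} \<in> edges H" "{x, q} \<in> edges H" "{x, r} \<in> edges H"
    using forest_four_vertices[OF sg fo _ _ no] A(1) by metis
  have leaves: "{p, q} \<notin> edges H" "{p, r} \<notin> edges H" "{q, r} \<notin> edges H"
    using forest_no_triangle[OF sg fo] x comm by blast+
  show False
  proof (cases "A = verts H")
    case True
    define f where "f = (\<lambda>v. if v = x then 0 else if v = p then 1 else if v = q then 2 else (3::nat))"
    have V: "verts H = {x, p, q, r}" using True x(1) by simp
    have f: "f x = 0" "f p = 1" "f q = 2" "f r = 3" using x(2) by (auto simp: f_def)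
    have se: "{i, j} \<in> edges (star_graph 3) \<longleftrightarrow> i = 0 \<and> j \<in> {1, 2, 3} \<or> j = 0 \<and> i \<in> {1, 2, 3}" for i j
      by (auto simp: star_graph_def doubleton_eq_iff)
    have loop: "{v} \<notin> edges H" for v using simple_graph_edgeD(3)[OF sg, of v v] by auto
    have "bij_betw f (verts H) (verts (star_graph 3))"
      unfolding V by (auto simp: bij_betw_def inj_on_def f star_graph_def)
    moreover have "\<forall>u\<in>verts H. \<forall>v\<in>verts H. {u, v} \<in> edges H \<longleftrightarrow> {f u, f v} \<in> edges (star_graph 3)"
      unfolding V se using x(3-5) leaves loop comm by (simp add: f)
    ultimately have "graph_iso H (star_graph 3)" unfolding graph_iso_def by blast
    then show False using star by blast
  next
    case False
    then obtain e where e: "e \<in> verts H" "e \<notin> {x, p, q, r}" using A(1) x(1) by blast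
    \<comment> \<open>The old leaves and \<open>e\<close> again form a star. Its centre is
      \<open>e\<close>, as the leaves are pairwise non-adjacent, and this closes a 4-cycle through
      \<open>x\<close>.\<close>
    have "{p, q, r, e} \<subseteq> verts H" "distinct [p, q, r, e]" using e x A(1) by auto
    then obtain x' p' q' r' where x': "{x', p', q', r'} = {p, q, r, e}" "distinct [x', p', q', r']"
      "{x', p'} \<in> edges H" "{x', q'} \<in> edges H" "{x', r'} \<in> edges H"
      using forest_four_vertices[OF sg fo _ _ no] by metis
    have adj: "{x', v} \<in> edges H" if "v \<in> {p, q, r, e}" "v \<noteq> x'" for v
      using that x'(3-5) unfolding x'(1)[symmetric] by blast
    have "x' \<noteq> p" "x' \<noteq> q" "x' \<noteq> r"
      using adj[of q] adj[of r] adj[of p] leaves comm[of r p] x(2) by auto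
    then have "x' = e" using x'(1) by blast
    then have "{e, p} \<in> edges H" "{e, q} \<in> edges H" using adj e(2) by auto
    then have "is_cycle H [x, p, e, q]"
      using x e A(1) comm by (intro is_cycle_4I) auto
    then show False using fo by (auto simp: is_forest_def)
  qed
qed

text \<open>\<open>f\<close> places \<open>H\<close> on the path with middle vertex
  \<open>1\<close>; only an edge between the two ends would fall outside it.\<close>

lemma subgraph_path3I:
  assumes sg: "simple_graph H" and f: "inj_on f (verts H)" "f ` verts H \<subseteq> {0, 1, 2::nat}"
    and e: "\<And>u v. {u, v} \<in> edges H \<Longrightarrow> {f u, f v} \<noteq> {0, 2}"
  shows "\<exists>K. subgraph K (path_graph 3) \<and> graph_iso H K"
proof -
  have "image f e \<in> edges (path_graph 3)" if "e \<in> edges H" for e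
  proof -
    have "card e = 2" using that sg by (simp add: simple_graph_def)
    then obtain u v where uv: "e = {u, v}" by (auto simp: card_2_iff)
    then have "f u \<noteq> f v" "f u \<in> {0, 1, 2}" "f v \<in> {0, 1, 2}"
      using that f simple_graph_edgeD[OF sg, of u v] by (auto simp: inj_on_eq_iff)
    moreover have "f u \<noteq> 0 \<or> f v \<noteq> 2" "f u \<noteq> 2 \<or> f v \<noteq> 0"
      using e[of u v] that uv by (auto simp: doubleton_eq_iff)
    ultimately have "Suc (f u) = f v \<and> f v < 3 \<or> Suc (f v) = f u \<and> f u < 3" by auto
    moreover have "{i, j} \<in> edges (path_graph 3)" if "Suc i = j" "j < 3" for i j
      using that by (auto simp: path_graph_def)
    ultimately show ?thesis unfolding uv by (metis image_insert image_empty insert_commute)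
  qed
  then have "subgraph (image_graph f H) (path_graph 3)"
    using simple_image_graph[OF sg f(1)] f(2)
    by (auto simp: subgraph_def image_graph_def path_graph_def)
  then show ?thesis using graph_iso_image_graph[OF sg f(1)] by blast
qed

lemma subgraph_path3_if_forest:
  assumes sg: "simple_graph H" and fo: "is_forest H" and card: "card (verts H) \<le> 3"
  shows "\<exists>K. subgraph K (path_graph 3) \<and> graph_iso H K"
proof (cases "card (verts H) = 3")
  case True
  have comm: "{x, y} \<in> edges H \<longleftrightarrow> {y, x} \<in> edges H" for x y by (simp add: insert_commute)
  obtain a b c where abc: "verts H = {a, b, c}" "distinct [a, b, c]"
    using True by (auto simp: card_3_iff)
  \<comment> \<open>Without a triangle some pair is non-adjacent; it takes the two ends of the
    path.\<close>
  then obtain x y z where xyz: "verts H = {x, y, z}" "distinct [x, y, z]" "{x, z} \<notin> edges H"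
  proof (cases "{a, b} \<in> edges H \<and> {b, c} \<in> edges H")
    case True
    then show ?thesis using that[of a b c] forest_no_triangle[OF sg fo] abc by blast
  next
    case False
    then show ?thesis using that[of a c b] that[of b a c] abc by auto
  qed
  define f where "f = (\<lambda>v. if v = x then 0 else if v = y then 1 else (2::nat))"
  have "{f u, f v} \<noteq> {0, 2}" if "{u, v} \<in> edges H" for u v
    using simple_graph_edgeD[OF sg that] that xyz comm
    by (auto simp: f_def doubleton_eq_iff split: if_splits)
  then show ?thesis
    using xyz by (intro subgraph_path3I[OF sg, of f]) (auto simp: f_def inj_on_def)
next
  case False
  have "finite (verts H)" using sg by (simp add: simple_graph_def)
  then obtain f where f: "bij_betw f (verts H) {..<card (verts H)}"
    by (metis ex_bij_betw_finite_nat atLeast0LessThan)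
  \<comment> \<open>With at most two vertices the labels \<open>0\<close> and \<open>1\<close>
    suffice, so the ends are never joined.\<close>
  have less: "f v < 2" if "v \<in> verts H" for v
    using bij_betwE[OF f] that card False by fastforce
  have "{f u, f v} \<noteq> {0, 2}" if "{u, v} \<in> edges H" for u v
    using less simple_graph_edgeD[OF sg that] by (fastforce simp: doubleton_eq_iff)
  moreover have "f ` verts H \<subseteq> {0, 1, 2}" using less by fastforce
  ultimately show ?thesis
    using f by (intro subgraph_path3I[OF sg, of f]) (auto simp: bij_betw_def)
qed

theorem theorem4:
  fixes H :: "'a graph"
  assumes "simple_graph H"
    and "\<not> graph_iso H (star_graph 3)"
  shows "ifvs_identical (free_near_bipartite_class H :: 'v::infinite graph set)
    \<longleftrightarrow> (\<exists>K. subgraph K (path_graph 3) \<and> graph_iso H K)"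
proof
  assume identical: "ifvs_identical (free_near_bipartite_class H :: 'v graph set)"
  then have fo: "is_forest H" using not_ifvs_identical_if_cycle assms(1) by blast
  have "card (verts H) \<le> 3"
  proof (rule ccontr)
    assume "\<not> card (verts H) \<le> 3"
    then obtain a b c d where "linear4 H a b c d"
      using linear4_if_forest[OF assms(1) fo _ assms(2)] by fastforce
    then have "\<not> ifvs_identical (free_near_bipartite_class H :: 'v graph set)"
      by (rule not_ifvs_identical_if_linear4)
    then show False using identical by blast
  qed
  then show "\<exists>K. subgraph K (path_graph 3) \<and> graph_iso H K"
    by (rule subgraph_path3_if_forest[OF assms(1) fo])
next
  assume "\<exists>K. subgraph K (path_graph 3) \<and> graph_iso H K"
  then show "ifvs_identical (free_near_bipartite_class H :: 'v graph set)"
    using ifvs_identical_if_subgraph_path3 by blast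
qed

end
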